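(* Let $(W,S)$ be a Coxeter system with $S$ finite and $L$ a positive weight function on $W$, with Hecke algebra $\mathcal H$. Suppose that $(\pi_\Gamma,\mathcal M_\Gamma,\mathsf B_\Gamma)_{\Gamma\in\Lambda}$ is a family of matrix representations of $\mathcal H$, indexed by the two-sided cells, satisfying B1--B5 and B4$'$, with bounds $\mathbf a_{\pi_\Gamma}$. Then $\mathbf a(w)=\mathbf a_{\pi_\Gamma}$ for all $\Gamma\in\Lambda$ and all $w\in\Gamma$, where $\mathbf a$ is Lusztig's $\mathbf a$-function.
   Context: A positive weight function is $L:W\to\mathbb N$ with $L(w)>0$ for $w\ne e$ and $L(ww')=L(w)+L(w')$ whenever $\ell(ww')=\ell(w)+\ell(w')$. $R=\mathbb Z[q,q^{-1}]$; $\mathcal H$ is the $R$-algebra with basis $\{T_w\}$ and $T_wT_s=T_{ws}$ if $\ell(ws)>\ell(w)$, $T_wT_s=T_{ws}+(q^{L(s)}-q^{-L(s)})T_w$ otherwise. The Kazhdan--Lusztig basis $\{C_w\}$ is the unique basis with $\overline{C_w}=C_w$ (bar involution: $\overline q=q^{-1}$, $\overline{T_w}=T_{w^{-1}}^{-1}$) and $C_w\in T_w+\sum_{y<w}q^{-1}\mathbb Z[q^{-1}]T_y$ ($<$ Bruhat order). $C_xC_y=\sum_zh_{x,y,z}C_z$. Lusztig's $\mathbf a$-function: $\mathbf a(z)=\min\{n\in\mathbb N\mid q^{-n}h_{x,y,z}\in\mathbb Z[q^{-1}]\ \forall x,y\in W\}$. The preorder $\le_{\mathcal{LR}}$ is the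 transitive closure of: $x\le y$ if $C_x$ appears in the Kazhdan--Lusztig expansion of $hC_yh'$ for some $h,h'\in\mathcal H$; $\Lambda$ is the set of its equivalence classes (two-sided cells), partially ordered by $\le_{\mathcal{LR}}$; $\Gamma_{\ge_{\mathcal{LR}}}=\{w\in W\mid\exists x\in\Gamma,\ w\ge_{\mathcal{LR}}x\}$. An $R$-polynomial ring is a (Laurent) polynomial ring $\mathsf S$ over $R$ in finitely many (possibly zero) commuting indeterminates; $\mathsf S^{\le0}$ and $\mathsf S^0$ are the corresponding subrings with coefficients in $\mathbb Z[q^{-1}]$ and $\mathbb Z$, and $\mathrm{sp}:\mathsf S^{\le0}\to\mathsf S^0$ is specialisation at $q^{-1}=0$. A matrix representation is a triple $(\pi,\mathcal M,\mathsf B)$ with $\mathcal M$ a right $\mathcal H$-module over an $R$-polynomial ring $\mathsf S$, and $\mathsf B$ an $\mathsf S$-basis of $\mathcal M$; matrices are defined by $u\cdot h=\sum_{v\in\mathsf B}[\pi(h)]_{u,v}v$. It is bounded if there is $n\ge0$ with $q^{-n}[\pi(C_w)]_{u,v}\in\mathsf S^{\le0}$ for all $u,v\in\mathsf B$, $w\in W$; the least such $n\in\mathbb N$ is the bound $\mathbf a_\pi$, and the leading matrices are $\mathfrak c_{\pi,w}=\mathrm{sp}(q^{-\mathbf a_\pi}\pi(C_w))$. Axioms for $(\pi_\Gamma,\mathcal M_\Gamma,\mathsf B_\Gamma)_{\Gamma\in\Lambda}$ (each over an $R$-polynomial ring $R_\Gamma$), for all $\Gamma$: B1. If $w\notin\Gamma_{\ge_{\mathcal{LR}}}$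 then $\pi_\Gamma(C_w)=0$. B2. The matrix representation is bounded, with bound $\mathbf a_{\pi_\Gamma}$. B3. $\mathfrak c_{\pi_\Gamma,w}\ne0$ if and only if $w\in\Gamma$. B4. The leading matrices $\mathfrak c_{\pi_\Gamma,w}$, $w\in\Gamma$, are free over $\mathbb Z$ (linearly independent). B5. If $\Gamma'\le_{\mathcal{LR}}\Gamma$ then $\mathbf a_{\pi_{\Gamma'}}\ge\mathbf a_{\pi_\Gamma}$. B4$'$. For each $z\in\Gamma$ there exists $(x,y)\in\Gamma^2$ with $\tilde\gamma_{x,y,z^{-1}}\neq0$, where $\tilde\gamma_{x,y,z^{-1}}$ is the coefficient of $q^{\mathbf a_{\pi_\Gamma}}$ in $h_{x,y,z}$. *)

theory Defs
  imports
    "HOL-Algebra.Module"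
    "HOL-Algebra.Multiplicative_Group"
    "HOL-Library.Poly_Mapping"
    "HOL-Library.Extended_Nat"
begin

hide_const (open) Poly_Mapping.range Poly_Mapping.map Poly_Mapping.degree Poly_Mapping.nth

section \<open>Coxeter systems, length, Bruhat order, weight functions\<close>

definition word_prod :: "('w, 'b) monoid_scheme \<Rightarrow> 'w list \<Rightarrow> 'w" where
  "word_prod W xs = foldr (\<lambda>x y. x \<otimes>\<^bsub>W\<^esub> y) xs \<one>\<^bsub>W\<^esub>"

text \<open>
  The congruence on words in \<open>S\<close> generated by the relations \<open>(s t)\<^sup>m = e\<close>, where \<open>m\<close> is the order
  of \<open>s t\<close> in \<open>W\<close>. The library's \<open>group.ord\<close> is \<open>0\<close> for an element of infinite order, which
  contributes the trivial relation; the case \<open>s = t\<close> gives \<open>s\<^sup>2 = e\<close>.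
\<close>

inductive coxeter_cong :: "('w, 'b) monoid_scheme \<Rightarrow> 'w set \<Rightarrow> 'w list \<Rightarrow> 'w list \<Rightarrow> bool"
  for W S where
  cong_refl: "coxeter_cong W S xs xs"
| cong_sym: "coxeter_cong W S xs ys \<Longrightarrow> coxeter_cong W S ys xs"
| cong_trans: "coxeter_cong W S xs ys \<Longrightarrow> coxeter_cong W S ys zs \<Longrightarrow> coxeter_cong W S xs zs"
| cong_rel: "s \<in> S \<Longrightarrow> t \<in> S \<Longrightarrow>
    coxeter_cong W S (xs @ concat (replicate (group.ord W (s \<otimes>\<^bsub>W\<^esub> t)) [s, t]) @ ys) (xs @ ys)"

text \<open>
  \<open>S\<close> consists of involutions, generates \<open>W\<close>, and the relations \<open>(s t)\<^bsup>ord(s t)\<^esup> = e\<close>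
  are a presentation of \<open>W\<close>. As \<open>s\<^sup>2 = e\<close> is among the relations, the monoid presentation
  is the group presentation.
\<close>

definition coxeter_system :: "('w, 'b) monoid_scheme \<Rightarrow> 'w set \<Rightarrow> bool" where
  "coxeter_system W S \<longleftrightarrow>
     group W \<and> S \<subseteq> carrier W \<and>
     (\<forall>s\<in>S. s \<noteq> \<one>\<^bsub>W\<^esub> \<and> s \<otimes>\<^bsub>W\<^esub> s = \<one>\<^bsub>W\<^esub>) \<and>
     (\<forall>w\<in>carrier W. \<exists>xs\<in>lists S. word_prod W xs = w) \<and>
     (\<forall>xs\<in>lists S. \<forall>ys\<in>lists S. word_prod W xs = word_prod W ys \<longrightarrow> coxeter_cong W S xs ys)"

definition cox_length :: "('w, 'b) monoid_scheme \<Rightarrow> 'w set \<Rightarrow> 'w \<Rightarrow> nat" where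
  "cox_length W S w = (LEAST n. \<exists>xs\<in>lists S. word_prod W xs = w \<and> length xs = n)"

definition reflections :: "('w, 'b) monoid_scheme \<Rightarrow> 'w set \<Rightarrow> 'w set" where
  "reflections W S = {w \<otimes>\<^bsub>W\<^esub> s \<otimes>\<^bsub>W\<^esub> inv\<^bsub>W\<^esub> w | w s. w \<in> carrier W \<and> s \<in> S}"

definition bruhat_less :: "('w, 'b) monoid_scheme \<Rightarrow> 'w set \<Rightarrow> 'w \<Rightarrow> 'w \<Rightarrow> bool" where
  "bruhat_less W S =
     (\<lambda>u v. u \<in> carrier W \<and> v \<in> carrier W \<and>
        (\<exists>t\<in>reflections W S. v = u \<otimes>\<^bsub>W\<^esub> t) \<and> cox_length W S u < cox_length W S v)\<^sup>+\<^sup>+"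

definition positive_weight :: "('w, 'b) monoid_scheme \<Rightarrow> 'w set \<Rightarrow> ('w \<Rightarrow> nat) \<Rightarrow> bool" where
  "positive_weight W S L \<longleftrightarrow>
     (\<forall>w\<in>carrier W. w \<noteq> \<one>\<^bsub>W\<^esub> \<longrightarrow> L w > 0) \<and>
     (\<forall>w\<in>carrier W. \<forall>w'\<in>carrier W.
        cox_length W S (w \<otimes>\<^bsub>W\<^esub> w') = cox_length W S w + cox_length W S w' \<longrightarrow>
        L (w \<otimes>\<^bsub>W\<^esub> w') = L w + L w')"


section \<open>The ring of Laurent polynomials and polynomial rings over it\<close>

text \<open>
  \<open>laurent\<close> is \<open>\<int>[q, q\<^sup>-\<^sup>1]\<close>, the group ring of the integers: \<open>lookup r k\<close> is the coefficient of
  \<open>q\<^sup>k\<close>. \<open>mlaurent\<close> is the ring of Laurent polynomials over it in indeterminates \<open>x\<^sub>0, x\<^sub>1, \<dots>\<close>;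
  every \<open>R\<close>-polynomial ring is taken as a subring of it.
\<close>

type_synonym laurent = "int \<Rightarrow>\<^sub>0 int"
type_synonym mlaurent = "(nat \<Rightarrow>\<^sub>0 int) \<Rightarrow>\<^sub>0 laurent"

definition subring_of :: "'a::comm_ring_1 set \<Rightarrow> 'a ring" where
  "subring_of A = \<lparr>carrier = A, mult = (*), one = 1, zero = 0, add = (+)\<rparr>"

definition laurent_ring :: "laurent ring" where
  "laurent_ring = subring_of UNIV"

definition q_pow :: "int \<Rightarrow> laurent" where
  "q_pow k = Poly_Mapping.single k 1"

text \<open>\<open>\<int>[q\<^sup>-\<^sup>1]\<close> and \<open>q\<^sup>-\<^sup>1\<int>[q\<^sup>-\<^sup>1]\<close>\<close>

definition laurent_nonpos :: "laurent set" where
  "laurent_nonpos = {r. Poly_Mapping.keys r \<subseteq> {..0}}"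

definition laurent_neg :: "laurent set" where
  "laurent_neg = {r. Poly_Mapping.keys r \<subseteq> {..<0}}"

definition laurent_bar :: "laurent \<Rightarrow> laurent" where
  "laurent_bar r = Poly_Mapping.map_key uminus r"

definition of_laurent :: "laurent \<Rightarrow> mlaurent" where
  "of_laurent r = Poly_Mapping.single 0 r"

definition polynomial_ring :: "nat \<Rightarrow> mlaurent ring" where
  "polynomial_ring n = subring_of
     {f. \<forall>e\<in>Poly_Mapping.keys f. Poly_Mapping.keys e \<subseteq> {..<n} \<and> (\<forall>i. Poly_Mapping.lookup e i \<ge> 0)}"

definition laurent_polynomial_ring :: "nat \<Rightarrow> mlaurent ring" where
  "laurent_polynomial_ring n = subring_of
     {f. \<forall>e\<in>Poly_Mapping.keys f. Poly_Mapping.keys e \<subseteq> {..<n}}"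

definition R_polynomial_ring :: "mlaurent ring \<Rightarrow> bool" where
  "R_polynomial_ring A \<longleftrightarrow> (\<exists>n. A = polynomial_ring n \<or> A = laurent_polynomial_ring n)"

definition nonpos_part :: "mlaurent ring \<Rightarrow> mlaurent set" where
  "nonpos_part A = {f \<in> carrier A. \<forall>e. Poly_Mapping.lookup f e \<in> laurent_nonpos}"

text \<open>Specialisation at \<open>q\<^sup>-\<^sup>1 = 0\<close>, meaningful on \<open>nonpos_part\<close>; the target, with integer
  coefficients, is kept inside the same type.\<close>

definition sp :: "mlaurent \<Rightarrow> mlaurent" where
  "sp f = Poly_Mapping.map (\<lambda>r. Poly_Mapping.single 0 (Poly_Mapping.lookup r 0)) f"


section \<open>Bases of modules\<close>

definition coeff_families :: "('r, 'k) ring_scheme \<Rightarrow> 'i set \<Rightarrow> ('i \<Rightarrow> 'r) set" where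
  "coeff_families K I =
     {c. (\<forall>i\<in>I. c i \<in> carrier K) \<and> (\<forall>i. i \<notin> I \<longrightarrow> c i = \<zero>\<^bsub>K\<^esub>) \<and> finite {i. c i \<noteq> \<zero>\<^bsub>K\<^esub>}}"

definition lin_comb ::
  "('r, 'k) ring_scheme \<Rightarrow> ('r, 'm, 'e) module_scheme \<Rightarrow> ('i \<Rightarrow> 'm) \<Rightarrow> ('i \<Rightarrow> 'r) \<Rightarrow> 'm" where
  "lin_comb K M b c = (\<Oplus>\<^bsub>M\<^esub>i\<in>{i. c i \<noteq> \<zero>\<^bsub>K\<^esub>}. c i \<odot>\<^bsub>M\<^esub> b i)"

definition is_basis ::
  "('r, 'k) ring_scheme \<Rightarrow> ('r, 'm, 'e) module_scheme \<Rightarrow> 'i set \<Rightarrow> ('i \<Rightarrow> 'm) \<Rightarrow> bool" where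
  "is_basis K M I b \<longleftrightarrow>
     b ` I \<subseteq> carrier M \<and> (\<forall>m\<in>carrier M. \<exists>!c. c \<in> coeff_families K I \<and> lin_comb K M b c = m)"

definition coord ::
  "('r, 'k) ring_scheme \<Rightarrow> ('r, 'm, 'e) module_scheme \<Rightarrow> 'i set \<Rightarrow> ('i \<Rightarrow> 'm) \<Rightarrow> 'm \<Rightarrow> 'i \<Rightarrow> 'r" where
  "coord K M I b m = (THE c. c \<in> coeff_families K I \<and> lin_comb K M b c = m)"


section \<open>Hecke algebra and Kazhdan--Lusztig basis\<close>

text \<open>\<open>H\<close> is the \<open>R\<close>-algebra with basis \<open>T\<^sub>w\<close> and the given multiplication. The library's
  \<open>algebra\<close> requires commutativity, hence the explicit conditions.\<close>

definition hecke_algebra ::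
  "('w, 'b) monoid_scheme \<Rightarrow> 'w set \<Rightarrow> ('w \<Rightarrow> nat) \<Rightarrow> (laurent, 'h) module \<Rightarrow> ('w \<Rightarrow> 'h) \<Rightarrow> bool" where
  "hecke_algebra W S L H T \<longleftrightarrow>
     ring H \<and> module laurent_ring H \<and>
     (\<forall>r. \<forall>x\<in>carrier H. \<forall>y\<in>carrier H.
        (r \<odot>\<^bsub>H\<^esub> x) \<otimes>\<^bsub>H\<^esub> y = r \<odot>\<^bsub>H\<^esub> (x \<otimes>\<^bsub>H\<^esub> y) \<and> x \<otimes>\<^bsub>H\<^esub> (r \<odot>\<^bsub>H\<^esub> y) = r \<odot>\<^bsub>H\<^esub> (x \<otimes>\<^bsub>H\<^esub> y)) \<and>
     is_basis laurent_ring H (carrier W) T \<and>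
     (\<forall>w\<in>carrier W. \<forall>s\<in>S.
        T w \<otimes>\<^bsub>H\<^esub> T s =
          (if cox_length W S (w \<otimes>\<^bsub>W\<^esub> s) > cox_length W S w then T (w \<otimes>\<^bsub>W\<^esub> s)
           else T (w \<otimes>\<^bsub>W\<^esub> s) \<oplus>\<^bsub>H\<^esub> (q_pow (int (L s)) - q_pow (- int (L s))) \<odot>\<^bsub>H\<^esub> T w))"

definition hecke_bar ::
  "('w, 'b) monoid_scheme \<Rightarrow> (laurent, 'h) module \<Rightarrow> ('w \<Rightarrow> 'h) \<Rightarrow> 'h \<Rightarrow> 'h" where
  "hecke_bar W H T h =
     lin_comb laurent_ring H (\<lambda>w. inv\<^bsub>H\<^esub> (T (inv\<^bsub>W\<^esub> w)))
       (\<lambda>w. laurent_bar (coord laurent_ring H (carrier W) T h w))"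

definition kl_basis ::
  "('w, 'b) monoid_scheme \<Rightarrow> 'w set \<Rightarrow> (laurent, 'h) module \<Rightarrow> ('w \<Rightarrow> 'h) \<Rightarrow> ('w \<Rightarrow> 'h) \<Rightarrow> bool" where
  "kl_basis W S H T C \<longleftrightarrow>
     is_basis laurent_ring H (carrier W) C \<and>
     (\<forall>w\<in>carrier W.
        hecke_bar W H T (C w) = C w \<and>
        coord laurent_ring H (carrier W) T (C w) w = 1 \<and>
        (\<forall>y\<in>carrier W. y \<noteq> w \<longrightarrow> coord laurent_ring H (carrier W) T (C w) y \<noteq> 0 \<longrightarrow>
           bruhat_less W S y w \<and> coord laurent_ring H (carrier W) T (C w) y \<in> laurent_neg))"

definition kl_coeff ::
  "('w, 'b) monoid_scheme \<Rightarrow> (laurent, 'h) module \<Rightarrow> ('w \<Rightarrow> 'h) \<Rightarrow> 'h \<Rightarrow> 'w \<Rightarrow> laurent" where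
  "kl_coeff W H C h z = coord laurent_ring H (carrier W) C h z"

text \<open>The structure constants \<open>h\<^bsub>x,y,z\<^esub>\<close>\<close>

definition kl_struct ::
  "('w, 'b) monoid_scheme \<Rightarrow> (laurent, 'h) module \<Rightarrow> ('w \<Rightarrow> 'h) \<Rightarrow> 'w \<Rightarrow> 'w \<Rightarrow> 'w \<Rightarrow> laurent" where
  "kl_struct W H C x y z = kl_coeff W H C (C x \<otimes>\<^bsub>H\<^esub> C y) z"

text \<open>The minimum is taken in the extended naturals, so that it is \<open>\<infinity>\<close> when no such \<open>n\<close> exists.\<close>

definition lusztig_a ::
  "('w, 'b) monoid_scheme \<Rightarrow> (laurent, 'h) module \<Rightarrow> ('w \<Rightarrow> 'h) \<Rightarrow> 'w \<Rightarrow> enat" where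
  "lusztig_a W H C z =
     Inf (enat ` {n. \<forall>x\<in>carrier W. \<forall>y\<in>carrier W.
                       q_pow (- int n) * kl_struct W H C x y z \<in> laurent_nonpos})"


section \<open>Two-sided cells\<close>

definition le_LR ::
  "('w, 'b) monoid_scheme \<Rightarrow> (laurent, 'h) module \<Rightarrow> ('w \<Rightarrow> 'h) \<Rightarrow> 'w \<Rightarrow> 'w \<Rightarrow> bool" where
  "le_LR W H C =
     (\<lambda>x y. x \<in> carrier W \<and> y \<in> carrier W \<and>
        (\<exists>h\<in>carrier H. \<exists>h'\<in>carrier H. kl_coeff W H C (h \<otimes>\<^bsub>H\<^esub> C y \<otimes>\<^bsub>H\<^esub> h') x \<noteq> 0))\<^sup>+\<^sup>+"

definition two_sided_cells ::
  "('w, 'b) monoid_scheme \<Rightarrow> (laurent, 'h) module \<Rightarrow> ('w \<Rightarrow> 'h) \<Rightarrow> 'w set set" where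
  "two_sided_cells W H C = carrier W // {(x, y). le_LR W H C x y \<and> le_LR W H C y x}"

definition cell_le ::
  "('w, 'b) monoid_scheme \<Rightarrow> (laurent, 'h) module \<Rightarrow> ('w \<Rightarrow> 'h) \<Rightarrow> 'w set \<Rightarrow> 'w set \<Rightarrow> bool" where
  "cell_le W H C \<Gamma>' \<Gamma> \<longleftrightarrow> (\<exists>x\<in>\<Gamma>'. \<exists>y\<in>\<Gamma>. le_LR W H C x y)"

definition cell_above ::
  "('w, 'b) monoid_scheme \<Rightarrow> (laurent, 'h) module \<Rightarrow> ('w \<Rightarrow> 'h) \<Rightarrow> 'w set \<Rightarrow> 'w set" where
  "cell_above W H C \<Gamma> = {w \<in> carrier W. \<exists>x\<in>\<Gamma>. le_LR W H C x w}"


section \<open>Matrix representations\<close>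

text \<open>\<open>rep_action \<rho> h u\<close> is \<open>u \<cdot> h\<close> in the right \<open>H\<close>-module. The basis may be infinite.\<close>

record ('h, 'm) matrix_rep =
  rep_ring :: "mlaurent ring"
  rep_module :: "(mlaurent, 'm) module"
  rep_action :: "'h \<Rightarrow> 'm \<Rightarrow> 'm"
  rep_basis :: "'m set"

definition matrix_representation :: "(laurent, 'h) module \<Rightarrow> ('h, 'm) matrix_rep \<Rightarrow> bool" where
  "matrix_representation H \<rho> \<longleftrightarrow>
     (let A = rep_ring \<rho>; M = rep_module \<rho>; act = rep_action \<rho> in
        R_polynomial_ring A \<and> module A M \<and>
        (\<forall>h\<in>carrier H. \<forall>u\<in>carrier M. act h u \<in> carrier M) \<and>
        (\<forall>h\<in>carrier H. \<forall>u\<in>carrier M. \<forall>v\<in>carrier M.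
           act h (u \<oplus>\<^bsub>M\<^esub> v) = act h u \<oplus>\<^bsub>M\<^esub> act h v) \<and>
        (\<forall>h\<in>carrier H. \<forall>a\<in>carrier A. \<forall>u\<in>carrier M.
           act h (a \<odot>\<^bsub>M\<^esub> u) = a \<odot>\<^bsub>M\<^esub> act h u) \<and>
        (\<forall>h\<in>carrier H. \<forall>h'\<in>carrier H. \<forall>u\<in>carrier M.
           act (h \<oplus>\<^bsub>H\<^esub> h') u = act h u \<oplus>\<^bsub>M\<^esub> act h' u) \<and>
        (\<forall>h\<in>carrier H. \<forall>h'\<in>carrier H. \<forall>u\<in>carrier M.
           act (h \<otimes>\<^bsub>H\<^esub> h') u = act h' (act h u)) \<and>
        (\<forall>u\<in>carrier M. act \<one>\<^bsub>H\<^esub> u = u) \<and>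
        (\<forall>r. \<forall>h\<in>carrier H. \<forall>u\<in>carrier M.
           act (r \<odot>\<^bsub>H\<^esub> h) u = of_laurent r \<odot>\<^bsub>M\<^esub> act h u) \<and>
        is_basis A M (rep_basis \<rho>) (\<lambda>v. v))"

definition rep_matrix :: "('h, 'm) matrix_rep \<Rightarrow> 'h \<Rightarrow> 'm \<Rightarrow> 'm \<Rightarrow> mlaurent" where
  "rep_matrix \<rho> h u v =
     coord (rep_ring \<rho>) (rep_module \<rho>) (rep_basis \<rho>) (\<lambda>v. v) (rep_action \<rho> h u) v"

definition rep_bounded_by ::
  "('w, 'b) monoid_scheme \<Rightarrow> ('w \<Rightarrow> 'h) \<Rightarrow> ('h, 'm) matrix_rep \<Rightarrow> nat \<Rightarrow> bool" where
  "rep_bounded_by W C \<rho> n \<longleftrightarrow>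
     (\<forall>w\<in>carrier W. \<forall>u\<in>rep_basis \<rho>. \<forall>v\<in>rep_basis \<rho>.
        of_laurent (q_pow (- int n)) * rep_matrix \<rho> (C w) u v \<in> nonpos_part (rep_ring \<rho>))"

definition rep_bounded ::
  "('w, 'b) monoid_scheme \<Rightarrow> ('w \<Rightarrow> 'h) \<Rightarrow> ('h, 'm) matrix_rep \<Rightarrow> bool" where
  "rep_bounded W C \<rho> \<longleftrightarrow> (\<exists>n. rep_bounded_by W C \<rho> n)"

definition rep_bound ::
  "('w, 'b) monoid_scheme \<Rightarrow> ('w \<Rightarrow> 'h) \<Rightarrow> ('h, 'm) matrix_rep \<Rightarrow> nat" where
  "rep_bound W C \<rho> = (LEAST n. rep_bounded_by W C \<rho> n)"

definition leading_matrix ::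
  "('w, 'b) monoid_scheme \<Rightarrow> ('w \<Rightarrow> 'h) \<Rightarrow> ('h, 'm) matrix_rep \<Rightarrow> 'w \<Rightarrow> 'm \<Rightarrow> 'm \<Rightarrow> mlaurent" where
  "leading_matrix W C \<rho> w u v =
     sp (of_laurent (q_pow (- int (rep_bound W C \<rho>))) * rep_matrix \<rho> (C w) u v)"

definition zero_matrix_on :: "'m set \<Rightarrow> ('m \<Rightarrow> 'm \<Rightarrow> mlaurent) \<Rightarrow> bool" where
  "zero_matrix_on B X \<longleftrightarrow> (\<forall>u\<in>B. \<forall>v\<in>B. X u v = 0)"

definition matrices_free_over_int ::
  "'m set \<Rightarrow> 'w set \<Rightarrow> ('w \<Rightarrow> 'm \<Rightarrow> 'm \<Rightarrow> mlaurent) \<Rightarrow> bool" where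
  "matrices_free_over_int B I X \<longleftrightarrow>
     (\<forall>F (c :: 'w \<Rightarrow> int). finite F \<longrightarrow> F \<subseteq> I \<longrightarrow>
        zero_matrix_on B (\<lambda>u v. \<Sum>w\<in>F. of_int (c w) * X w u v) \<longrightarrow> (\<forall>w\<in>F. c w = 0))"

end

theory Submission
  imports Defs
begin

text \<open>
  Write \<open>a\<^sub>\<Gamma>\<close> for the bound of \<open>\<pi>\<^sub>\<Gamma>\<close>. Axiom B4' says that \<open>a(z) \<ge> a\<^sub>\<Gamma>\<close> for \<open>z \<in> \<Gamma>\<close>. For the converse fix
  \<open>x, y\<close>; only finitely many \<open>h\<^bsub>x,y,z\<^esub>\<close> are nonzero, so if some of them had degree greater than the bound of
  the cell of \<open>z\<close>, one could choose such a \<open>z\<close> in a cell \<open>\<Gamma>\<close> that is maximal for \<open>\<le>\<^bsub>LR\<^esub>\<close>. Let \<open>N > a\<^sub>\<Gamma>\<close> be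
  the largest degree of \<open>h\<^bsub>x,y,z\<^esub>\<close> over \<open>z \<in> \<Gamma>\<close>. In \<open>\<pi>\<^sub>\<Gamma>(C\<^sub>x) \<pi>\<^sub>\<Gamma>(C\<^sub>y) = \<Sum>\<^sub>z h\<^bsub>x,y,z\<^esub> \<pi>\<^sub>\<Gamma>(C\<^sub>z)\<close> the terms
  from cells not above \<open>\<Gamma>\<close> vanish by B1, and those from cells strictly above \<open>\<Gamma>\<close> have degree at most
  \<open>2 a\<^sub>\<Gamma>\<close> by maximality and B5, as does the left-hand side. Hence the coefficient of \<open>q\<^bsup>N + a\<^sub>\<Gamma>\<^esup>\<close>, which is an
  integral linear combination of leading matrices with some nonzero coefficient, is \<open>0\<close>, against B4.
\<close>


section \<open>Degrees in \<open>q\<close>\<close>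

text \<open>Phrased by vanishing coefficients instead of a maximum: the zero element meets every
  bound, and one \<open>n\<close> serves all monomials in the other indeterminates.\<close>

definition q_degree_le :: "mlaurent \<Rightarrow> int \<Rightarrow> bool" where
  "q_degree_le f n \<longleftrightarrow> (\<forall>e k. k > n \<longrightarrow> Poly_Mapping.lookup (Poly_Mapping.lookup f e) k = 0)"

lemma lookup_Sum_any_zero:
  assumes "\<And>a. Poly_Mapping.lookup (g a) k = 0"
  shows "Poly_Mapping.lookup (Sum_any g) k = 0"
  by (simp add: Sum_any.expand_set lookup_sum assms)

text \<open>Exponents form a group, so in the convolution the second exponent is determined by the
  first and the inner sum collapses.\<close>

lemma laurent_lookup_mult:
  fixes r s :: laurent
  shows "Poly_Mapping.lookup (r * s) k
    = Sum_any (\<lambda>l. Poly_Mapping.lookup r l * Poly_Mapping.lookup s (k - l))"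
proof -
  have "Sum_any (\<lambda>j. Poly_Mapping.lookup s j when k = l + j) = Poly_Mapping.lookup s (k - l)" for l
  proof -
    have "(\<lambda>j. Poly_Mapping.lookup s j when k = l + j)
        = (\<lambda>j. Poly_Mapping.lookup s j when j = k - l)"
      by (auto simp: fun_eq_iff when_def)
    then show ?thesis by (simp only: Sum_any_when_equal)
  qed
  then show ?thesis by (simp add: lookup_mult)
qed

text \<open>Only \<open>l = m\<close> survives: for \<open>l > m\<close> the first factor vanishes,
  for \<open>l < m\<close> the second. As \<open>m\<close> and \<open>n\<close> are mere upper
  bounds, both sides may be zero.\<close>

lemma laurent_lookup_mult_top:
  fixes r s :: laurent
  assumes "\<And>k. k > m \<Longrightarrow> Poly_Mapping.lookup r k = 0"
    and "\<And>k. k > n \<Longrightarrow> Poly_Mapping.lookup s k = 0"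
  shows "Poly_Mapping.lookup (r * s) (m + n) = Poly_Mapping.lookup r m * Poly_Mapping.lookup s n"
proof -
  have "Poly_Mapping.lookup r l * Poly_Mapping.lookup s (m + n - l)
      = (Poly_Mapping.lookup r m * Poly_Mapping.lookup s n when l = m)" for l
    using assms(1)[of l] assms(2)[of "m + n - l"] by (cases l m rule: linorder_cases) auto
  then show ?thesis by (simp add: laurent_lookup_mult)
qed

lemma laurent_lookup_mult_above:
  fixes r s :: laurent
  assumes "\<And>k. k > m \<Longrightarrow> Poly_Mapping.lookup r k = 0"
    and "\<And>k. k > n \<Longrightarrow> Poly_Mapping.lookup s k = 0"
    and "k > m + n"
  shows "Poly_Mapping.lookup (r * s) k = 0"
proof -
  have "Poly_Mapping.lookup r l * Poly_Mapping.lookup s (k - l) = 0" for l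
    using assms(1)[of l] assms(2)[of "k - l"] assms(3) by (cases "l > m") auto
  then show ?thesis by (simp only: laurent_lookup_mult Sum_any.neutral)
qed

lemma lookup_q_pow_mult: "Poly_Mapping.lookup (q_pow j * r) k = Poly_Mapping.lookup r (k - j)"
proof -
  have "Poly_Mapping.lookup (Poly_Mapping.single j 1) l * Poly_Mapping.lookup r (k - l)
      = (Poly_Mapping.lookup r (k - j) when l = j)" for l
    by (simp add: lookup_single when_def)
  then show ?thesis by (simp add: laurent_lookup_mult q_pow_def)
qed

text \<open>Multiplication by \<open>q_pow (- n)\<close> lowers every exponent by \<open>n\<close>.
  This turns both \<open>rep_bounded_by\<close> and \<open>lusztig_a\<close> into statements about
  degrees.\<close>

lemma q_pow_mult_nonpos_iff:
  "q_pow (- n) * r \<in> laurent_nonpos \<longleftrightarrow> (\<forall>k > n. Poly_Mapping.lookup r k = 0)"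
proof -
  have "q_pow (- n) * r \<in> laurent_nonpos \<longleftrightarrow> (\<forall>k > 0. Poly_Mapping.lookup r (k + n) = 0)"
    by (force simp: laurent_nonpos_def in_keys_iff lookup_q_pow_mult)
  also have "\<dots> \<longleftrightarrow> (\<forall>k > n. Poly_Mapping.lookup r k = 0)"
    by (metis add.commute add_diff_cancel_left' diff_gt_0_iff_gt add_diff_eq
        less_add_same_cancel1)
  finally show ?thesis .
qed

lemma lookup_of_laurent_mult:
  "Poly_Mapping.lookup (of_laurent r * f) e = r * Poly_Mapping.lookup f e"
  unfolding of_laurent_def mult_map_scale_conv_mult[symmetric]
  by (simp add: map.rep_eq when_def)

text \<open>One direction only, because \<open>nonpos_part A\<close> also records membership in
  \<open>A\<close>.\<close>

lemma of_laurent_mult_nonpos_imp_degree_le: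
  assumes "of_laurent (q_pow (- n)) * f \<in> nonpos_part A"
  shows "q_degree_le f n"
  using assms by (auto simp: nonpos_part_def lookup_of_laurent_mult q_pow_mult_nonpos_iff q_degree_le_def)

lemma q_degree_le_mult:
  assumes "q_degree_le f m" "q_degree_le g n"
  shows "q_degree_le (f * g) (m + n)"
  unfolding q_degree_le_def
proof (intro allI impI)
  fix e k assume k: "k > m + n"
  \<comment> \<open>For a fixed exponent \<open>l\<close> taken from \<open>f\<close>, the inner sum
    is the matching coefficient of \<open>g\<close>, hence of degree at most
    \<open>n\<close>.\<close>
  have "Poly_Mapping.lookup (Sum_any (\<lambda>d. Poly_Mapping.lookup g d when e = l + d)) i = 0"
    if "i > n" for l i
    using assms(2) that by (intro lookup_Sum_any_zero) (simp add: when_def q_degree_le_def)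
  then have "Poly_Mapping.lookup (Poly_Mapping.lookup f l *
      Sum_any (\<lambda>d. Poly_Mapping.lookup g d when e = l + d)) k = 0" for l
    using assms(1) k by (intro laurent_lookup_mult_above[of m _ n]) (simp_all only: q_degree_le_def)
  then show "Poly_Mapping.lookup (Poly_Mapping.lookup (f * g) e) k = 0"
    by (subst lookup_mult) (rule lookup_Sum_any_zero)
qed

lemma q_degree_le_sum: "(\<And>i. i \<in> F \<Longrightarrow> q_degree_le (f i) n) \<Longrightarrow> q_degree_le (sum f F) n"
  by (simp add: q_degree_le_def lookup_sum)

section \<open>Coefficients under specialisation and integer scalars\<close>

lemma lookup_sp:
  "Poly_Mapping.lookup (Poly_Mapping.lookup (sp f) e) k
    = (Poly_Mapping.lookup (Poly_Mapping.lookup f e) 0 when k = 0)"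
  by (auto simp: sp_def map.rep_eq when_def lookup_single)

lemma lookup_of_int_mult:
  fixes f :: mlaurent
  shows "Poly_Mapping.lookup (Poly_Mapping.lookup (of_int c * f) e) k
    = c * Poly_Mapping.lookup (Poly_Mapping.lookup f e) k"
proof -
  have "of_int c = of_laurent (Poly_Mapping.single 0 c)"
    by (metis of_int_eq_id id_apply of_laurent_def single_of_int)
  moreover have "Poly_Mapping.lookup (Poly_Mapping.single 0 c * r) k = c * Poly_Mapping.lookup r k"
    for r :: laurent
    unfolding mult_map_scale_conv_mult[symmetric] by (simp add: map.rep_eq when_def)
  ultimately show ?thesis by (simp add: lookup_of_laurent_mult)
qed


section \<open>Coordinates\<close>

context module
begin

text \<open>\<open>lin_comb\<close> sums over the exact support of its family. Passing to a larger
  finite set makes families with different supports comparable.\<close>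

lemma lin_comb_superset:
  assumes "c \<in> coeff_families R I" "b ` I \<subseteq> carrier M"
    and "finite F" "F \<subseteq> I" "{i. c i \<noteq> \<zero>} \<subseteq> F"
  shows "lin_comb R M b c = (\<Oplus>\<^bsub>M\<^esub>i\<in>F. c i \<odot>\<^bsub>M\<^esub> b i)"
  unfolding lin_comb_def using assms
  by (intro M.add.finprod_mono_neutral_cong_left)
    (auto simp: coeff_families_def subset_iff image_subset_iff)

context
  fixes I :: "'i set" and b :: "'i \<Rightarrow> 'c"
  assumes basis: "is_basis R M I b"
begin

lemma coord_props:
  assumes "m \<in> carrier M"
  shows "coord R M I b m \<in> coeff_families R I" "lin_comb R M b (coord R M I b m) = m"
proof -
  have "\<exists>!c. c \<in> coeff_families R I \<and> lin_comb R M b c = m"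
    using basis assms by (simp add: is_basis_def)
  from theI'[OF this] show "coord R M I b m \<in> coeff_families R I"
    "lin_comb R M b (coord R M I b m) = m" by (simp_all add: coord_def)
qed

lemma coord_eqI:
  assumes "m \<in> carrier M" "c \<in> coeff_families R I" "lin_comb R M b c = m"
  shows "coord R M I b m = c"
  using basis assms coord_props[OF assms(1)] unfolding is_basis_def by blast

lemma coord_closed: "m \<in> carrier M \<Longrightarrow> coord R M I b m i \<in> carrier R"
  using coord_props(1)[of m] by (cases "i \<in> I") (auto simp: coeff_families_def)

lemma coord_support:
  assumes "m \<in> carrier M"
  shows "finite {i. coord R M I b m i \<noteq> \<zero>}" "{i. coord R M I b m i \<noteq> \<zero>} \<subseteq> I"
  using coord_props(1)[OF assms] by (auto simp: coeff_families_def)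

lemma coord_expansion:
  assumes "m \<in> carrier M"
  shows "m = (\<Oplus>\<^bsub>M\<^esub>i\<in>{i. coord R M I b m i \<noteq> \<zero>}. coord R M I b m i \<odot>\<^bsub>M\<^esub> b i)"
  using coord_props(2)[OF assms] by (simp add: lin_comb_def)

lemma coord_add:
  assumes "x \<in> carrier M" "y \<in> carrier M"
  shows "coord R M I b (x \<oplus>\<^bsub>M\<^esub> y) = (\<lambda>i. coord R M I b x i \<oplus> coord R M I b y i)"
proof (rule coord_eqI)
  let ?x = "coord R M I b x" and ?y = "coord R M I b y"
  \<comment> \<open>The union of both supports is the common summation range, since cancellation can
    make the support of the sum smaller.\<close>
  let ?F = "{i. ?x i \<noteq> \<zero>} \<union> {i. ?y i \<noteq> \<zero>}"
  have bI: "b ` I \<subseteq> carrier M" using basis by (simp add: is_basis_def)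
  have F: "finite ?F" "?F \<subseteq> I" using coord_support assms by auto
  have sub: "{i. ?x i \<oplus> ?y i \<noteq> \<zero>} \<subseteq> ?F" by auto
  show cf: "(\<lambda>i. ?x i \<oplus> ?y i) \<in> coeff_families R I"
    using coord_props(1)[OF assms(1)] coord_props(1)[OF assms(2)] finite_subset[OF sub F(1)]
    by (auto simp: coeff_families_def)
  have "lin_comb R M b (\<lambda>i. ?x i \<oplus> ?y i) = (\<Oplus>\<^bsub>M\<^esub>i\<in>?F. (?x i \<oplus> ?y i) \<odot>\<^bsub>M\<^esub> b i)"
    using cf bI F sub by (rule lin_comb_superset)
  also have "\<dots> = (\<Oplus>\<^bsub>M\<^esub>i\<in>?F. ?x i \<odot>\<^bsub>M\<^esub> b i \<oplus>\<^bsub>M\<^esub> ?y i \<odot>\<^bsub>M\<^esub> b i)"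
    using F bI assms by (intro M.finsum_cong') (auto simp: smult_l_distr coord_closed image_subset_iff subset_iff)
  also have "\<dots> = (\<Oplus>\<^bsub>M\<^esub>i\<in>?F. ?x i \<odot>\<^bsub>M\<^esub> b i) \<oplus>\<^bsub>M\<^esub> (\<Oplus>\<^bsub>M\<^esub>i\<in>?F. ?y i \<odot>\<^bsub>M\<^esub> b i)"
    using F bI assms by (intro M.finsum_addf) (auto simp: coord_closed image_subset_iff subset_iff)
  also have "\<dots> = lin_comb R M b ?x \<oplus>\<^bsub>M\<^esub> lin_comb R M b ?y"
    using F bI assms coord_props(1)
    by (subst (1 2) lin_comb_superset[where F = ?F]) auto
  finally show "lin_comb R M b (\<lambda>i. ?x i \<oplus> ?y i) = x \<oplus>\<^bsub>M\<^esub> y"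
    using assms by (simp add: coord_props)
qed (use assms in simp)

lemma coord_smult:
  assumes "a \<in> carrier R" "x \<in> carrier M"
  shows "coord R M I b (a \<odot>\<^bsub>M\<^esub> x) = (\<lambda>i. a \<otimes> coord R M I b x i)"
proof (rule coord_eqI)
  let ?x = "coord R M I b x"
  \<comment> \<open>Multiplication by \<open>a\<close> can annihilate coefficients, so both sums are
    taken over the support of \<open>x\<close>.\<close>
  let ?F = "{i. ?x i \<noteq> \<zero>}"
  have bI: "b ` I \<subseteq> carrier M" using basis by (simp add: is_basis_def)
  have F: "finite ?F" "?F \<subseteq> I" using coord_support assms by auto
  have sub: "{i. a \<otimes> ?x i \<noteq> \<zero>} \<subseteq> ?F" using assms by auto
  show cf: "(\<lambda>i. a \<otimes> ?x i) \<in> coeff_families R I"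
    using assms(1) coord_props(1)[OF assms(2)] finite_subset[OF sub F(1)]
    by (auto simp: coeff_families_def)
  have "lin_comb R M b (\<lambda>i. a \<otimes> ?x i) = (\<Oplus>\<^bsub>M\<^esub>i\<in>?F. (a \<otimes> ?x i) \<odot>\<^bsub>M\<^esub> b i)"
    using cf bI F sub by (rule lin_comb_superset)
  also have "\<dots> = (\<Oplus>\<^bsub>M\<^esub>i\<in>?F. a \<odot>\<^bsub>M\<^esub> (?x i \<odot>\<^bsub>M\<^esub> b i))"
    using F bI assms by (intro M.finsum_cong') (auto simp: smult_assoc1 coord_closed image_subset_iff subset_iff)
  also have "\<dots> = a \<odot>\<^bsub>M\<^esub> (\<Oplus>\<^bsub>M\<^esub>i\<in>?F. ?x i \<odot>\<^bsub>M\<^esub> b i)"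
    using F bI assms by (intro finsum_smult_ldistr[symmetric]) (auto simp: coord_closed image_subset_iff subset_iff)
  finally show "lin_comb R M b (\<lambda>i. a \<otimes> ?x i) = a \<odot>\<^bsub>M\<^esub> x"
    using coord_expansion[OF assms(2)] by simp
qed (use assms in simp)

lemma coord_zero: "coord R M I b \<zero>\<^bsub>M\<^esub> = (\<lambda>i. \<zero>)"
  by (rule coord_eqI) (auto simp: coeff_families_def lin_comb_def)

lemma coord_basis:
  assumes "i \<in> I" "\<one> \<noteq> \<zero>"
  shows "coord R M I b (b i) i = \<one>"
proof -
  have "b i \<in> carrier M" using basis assms by (auto simp: is_basis_def)
  moreover have "{j. (if j = i then \<one> else \<zero>) \<noteq> \<zero>} = {i}"
    using assms by auto
  ultimately have "coord R M I b (b i) = (\<lambda>j. if j = i then \<one> else \<zero>)"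
    using assms by (intro coord_eqI) (auto simp: coeff_families_def lin_comb_def)
  then show ?thesis by simp
qed

lemma coord_lin_comb:
  assumes "finite F" "\<And>j. j \<in> F \<Longrightarrow> a j \<in> carrier R" "\<And>j. j \<in> F \<Longrightarrow> x j \<in> carrier M"
  shows "coord R M I b (\<Oplus>\<^bsub>M\<^esub>j\<in>F. a j \<odot>\<^bsub>M\<^esub> x j) i = (\<Oplus>j\<in>F. a j \<otimes> coord R M I b (x j) i)"
  using assms
proof (induction F rule: finite_induct)
  case empty
  then show ?case by (simp add: coord_zero)
next
  case (insert j F)
  then show ?case
    by (subst M.finsum_insert R.finsum_insert;
        auto simp: Pi_iff coord_closed coord_add coord_smult)+
qed

end

end


section \<open>Matrices of a representation\<close>

text \<open>The coefficient rings are subsets of a type-class ring with the inherited operations.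
  Their sums become type-class sums, through which \<open>lookup\<close> passes.\<close>

lemma finsum_eq_sum:
  fixes A :: "'a::comm_ring_1 ring"
  assumes "ring A" "zero A = 0" "add A = (+)" "finite F" "\<And>i. i \<in> F \<Longrightarrow> f i \<in> carrier A"
  shows "finsum A f F = sum f F"
proof -
  interpret ring A by fact
  show ?thesis using assms(4,5)
  proof (induction F rule: finite_induct)
    case empty
    then show ?case by (simp add: assms(2))
  next
    case (insert i F)
    then show ?case by (subst finsum_insert) (auto simp: assms(3))
  qed
qed

lemma R_polynomial_ring_ops:
  assumes "R_polynomial_ring A"
  shows "mult A = (*)" "one A = 1" "zero A = 0" "add A = (+)"
  using assms
  by (auto simp: R_polynomial_ring_def polynomial_ring_def laurent_polynomial_ring_def subring_of_def)

lemma of_laurent_carrier: "R_polynomial_ring A \<Longrightarrow> of_laurent r \<in> carrier A"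
  by (auto simp: R_polynomial_ring_def polynomial_ring_def laurent_polynomial_ring_def
      subring_of_def of_laurent_def split: if_splits)

lemma laurent_ring_ops [simp]:
  "carrier laurent_ring = UNIV" "mult laurent_ring = (*)" "one laurent_ring = 1"
  "zero laurent_ring = 0" "add laurent_ring = (+)"
  by (simp_all add: laurent_ring_def subring_of_def)

text \<open>A single representation; the family indexed by the cells is handled by interpreting the
  locale at one chosen cell.\<close>

locale hecke_matrix_rep = H: ring H + HM: module laurent_ring H
  for H :: "(laurent, 'h) module" +
  fixes \<rho> :: "('h, 'm) matrix_rep"
  assumes matrix_rep: "matrix_representation H \<rho>"
begin

abbreviation "A \<equiv> rep_ring \<rho>"
abbreviation "M \<equiv> rep_module \<rho>"
abbreviation "act \<equiv> rep_action \<rho>"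
abbreviation "B \<equiv> rep_basis \<rho>"

lemma R_poly: "R_polynomial_ring A"
  and module_M: "module A M"
  and act_closed: "h \<in> carrier H \<Longrightarrow> u \<in> carrier M \<Longrightarrow> act h u \<in> carrier M"
  and act_add: "h \<in> carrier H \<Longrightarrow> u \<in> carrier M \<Longrightarrow> v \<in> carrier M \<Longrightarrow>
    act h (u \<oplus>\<^bsub>M\<^esub> v) = act h u \<oplus>\<^bsub>M\<^esub> act h v"
  and act_smult: "h \<in> carrier H \<Longrightarrow> a \<in> carrier A \<Longrightarrow> u \<in> carrier M \<Longrightarrow>
    act h (a \<odot>\<^bsub>M\<^esub> u) = a \<odot>\<^bsub>M\<^esub> act h u"
  and add_act: "h \<in> carrier H \<Longrightarrow> h' \<in> carrier H \<Longrightarrow> u \<in> carrier M \<Longrightarrow>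
    act (h \<oplus>\<^bsub>H\<^esub> h') u = act h u \<oplus>\<^bsub>M\<^esub> act h' u"
  and mult_act: "h \<in> carrier H \<Longrightarrow> h' \<in> carrier H \<Longrightarrow> u \<in> carrier M \<Longrightarrow>
    act (h \<otimes>\<^bsub>H\<^esub> h') u = act h' (act h u)"
  and smult_act: "h \<in> carrier H \<Longrightarrow> u \<in> carrier M \<Longrightarrow>
    act (r \<odot>\<^bsub>H\<^esub> h) u = of_laurent r \<odot>\<^bsub>M\<^esub> act h u"
  and basis_B: "is_basis A M B (\<lambda>v. v)"
  using matrix_rep unfolding matrix_representation_def Let_def by auto

sublocale M: module A M by (rule module_M)

lemmas ops [simp] = R_polynomial_ring_ops[OF R_poly]

lemma basis_closed: "u \<in> B \<Longrightarrow> u \<in> carrier M"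
  using basis_B by (auto simp: is_basis_def)

lemma sum_A: "finite F \<Longrightarrow> (\<And>i. i \<in> F \<Longrightarrow> f i \<in> carrier A) \<Longrightarrow> finsum A f F = sum f F"
  by (rule finsum_eq_sum[OF M.R.ring_axioms]) simp_all

lemma rep_matrix_closed: "h \<in> carrier H \<Longrightarrow> u \<in> B \<Longrightarrow> rep_matrix \<rho> h u v \<in> carrier A"
  unfolding rep_matrix_def by (intro M.coord_closed basis_B act_closed basis_closed)

text \<open>The zero vector is the zero scalar times itself, and the action commutes with
  scalars.\<close>

lemma act_zero: "h \<in> carrier H \<Longrightarrow> act h \<zero>\<^bsub>M\<^esub> = \<zero>\<^bsub>M\<^esub>"
  using act_smult[of h "\<zero>\<^bsub>A\<^esub>" "\<zero>\<^bsub>M\<^esub>"] act_closed[of h "\<zero>\<^bsub>M\<^esub>"] M.R.zero_closed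
    M.smult_l_null[of "\<zero>\<^bsub>M\<^esub>"] M.smult_l_null[of "act h \<zero>\<^bsub>M\<^esub>"] by simp

lemma act_lin_comb:
  assumes "h \<in> carrier H" "finite F"
    and "\<And>i. i \<in> F \<Longrightarrow> a i \<in> carrier A" "\<And>i. i \<in> F \<Longrightarrow> x i \<in> carrier M"
  shows "act h (\<Oplus>\<^bsub>M\<^esub>i\<in>F. a i \<odot>\<^bsub>M\<^esub> x i) = (\<Oplus>\<^bsub>M\<^esub>i\<in>F. a i \<odot>\<^bsub>M\<^esub> act h (x i))"
  using assms(2-)
proof (induction F rule: finite_induct)
  case empty
  then show ?case using act_zero[OF assms(1)] by simp
next
  case (insert i F)
  then show ?case
    by (subst (1 2) M.M.finsum_insert) (auto simp: Pi_iff assms(1) act_closed act_add act_smult)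
qed

text \<open>For a right module with row coordinates, acting by \<open>h\<close> and then by
  \<open>h'\<close> multiplies matrices in the same order. Each row has finite support, so the sum
  is finite even for an infinite basis.\<close>

lemma rep_matrix_mult:
  assumes h: "h \<in> carrier H" "h' \<in> carrier H" and u: "u \<in> B"
  shows "rep_matrix \<rho> (h \<otimes>\<^bsub>H\<^esub> h') u v
    = (\<Sum>w | rep_matrix \<rho> h u w \<noteq> 0. rep_matrix \<rho> h u w * rep_matrix \<rho> h' w v)"
proof -
  let ?F = "{w. rep_matrix \<rho> h u w \<noteq> 0}"
  have hu: "act h u \<in> carrier M" by (intro act_closed h basis_closed u)
  have F: "finite ?F" "?F \<subseteq> B"
    using M.coord_support[OF basis_B hu] by (simp_all add: rep_matrix_def)
  have cl: "w \<in> carrier M" if "w \<in> ?F" for w using that F by (auto intro: basis_closed)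
  have "act h u = (\<Oplus>\<^bsub>M\<^esub>w\<in>?F. rep_matrix \<rho> h u w \<odot>\<^bsub>M\<^esub> w)"
    using M.coord_expansion[OF basis_B hu] by (simp add: rep_matrix_def)
  then have "act (h \<otimes>\<^bsub>H\<^esub> h') u = (\<Oplus>\<^bsub>M\<^esub>w\<in>?F. rep_matrix \<rho> h u w \<odot>\<^bsub>M\<^esub> act h' w)"
    using act_lin_comb[OF h(2) F(1), of "rep_matrix \<rho> h u" "\<lambda>w. w"] cl
      mult_act[OF h basis_closed[OF u]] rep_matrix_closed[OF h(1) u] by simp
  then have "rep_matrix \<rho> (h \<otimes>\<^bsub>H\<^esub> h') u v
      = (\<Oplus>\<^bsub>A\<^esub>w\<in>?F. rep_matrix \<rho> h u w \<otimes>\<^bsub>A\<^esub> rep_matrix \<rho> h' w v)"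
    unfolding rep_matrix_def[of \<rho> "h \<otimes>\<^bsub>H\<^esub> h'"] rep_matrix_def[of \<rho> h']
    using M.coord_lin_comb[OF basis_B F(1), of "rep_matrix \<rho> h u" "act h'" v]
      cl rep_matrix_closed[OF h(1) u] act_closed[OF h(2)] by simp
  also have "\<dots> = (\<Sum>w\<in>?F. rep_matrix \<rho> h u w \<otimes>\<^bsub>A\<^esub> rep_matrix \<rho> h' w v)"
    by (intro sum_A F M.R.m_closed rep_matrix_closed h u) (use F in auto)
  finally show ?thesis by simp
qed

lemma rep_matrix_add:
  "\<lbrakk>h \<in> carrier H; h' \<in> carrier H; u \<in> B\<rbrakk> \<Longrightarrow>
    rep_matrix \<rho> (h \<oplus>\<^bsub>H\<^esub> h') u v = rep_matrix \<rho> h u v + rep_matrix \<rho> h' u v"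
  by (simp add: rep_matrix_def add_act basis_closed act_closed M.coord_add[OF basis_B])

lemma rep_matrix_smult:
  "\<lbrakk>h \<in> carrier H; u \<in> B\<rbrakk> \<Longrightarrow> rep_matrix \<rho> (r \<odot>\<^bsub>H\<^esub> h) u v = of_laurent r * rep_matrix \<rho> h u v"
  by (simp add: rep_matrix_def smult_act basis_closed act_closed
      M.coord_smult[OF basis_B] of_laurent_carrier[OF R_poly])

lemma rep_matrix_zero: "u \<in> B \<Longrightarrow> rep_matrix \<rho> \<zero>\<^bsub>H\<^esub> u v = 0"
  using rep_matrix_add[of "\<zero>\<^bsub>H\<^esub>" "\<zero>\<^bsub>H\<^esub>" u v] by simp

lemma rep_matrix_lin_comb:
  assumes "u \<in> B" "finite F" "\<And>i. i \<in> F \<Longrightarrow> x i \<in> carrier H"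
  shows "rep_matrix \<rho> (\<Oplus>\<^bsub>H\<^esub>i\<in>F. r i \<odot>\<^bsub>H\<^esub> x i) u v
    = (\<Sum>i\<in>F. of_laurent (r i) * rep_matrix \<rho> (x i) u v)"
  using assms(2,3)
proof (induction F rule: finite_induct)
  case empty
  then show ?case using assms(1) by (simp add: rep_matrix_zero)
next
  case (insert i F)
  then show ?case
    by (subst H.finsum_insert)
      (auto simp: Pi_iff HM.smult_closed rep_matrix_add rep_matrix_smult assms(1))
qed

text \<open>Taking a matrix entry is linear in \<open>h\<close>. With \<open>h\<close> a product of
  two basis elements, the coefficients are the structure constants.\<close>

lemma rep_matrix_expansion:
  assumes C: "is_basis laurent_ring H I C" and h: "h \<in> carrier H" and u: "u \<in> B"
  shows "rep_matrix \<rho> h u v = (\<Sum>z | coord laurent_ring H I C h z \<noteq> 0.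
    of_laurent (coord laurent_ring H I C h z) * rep_matrix \<rho> (C z) u v)"
proof -
  have sup: "finite {z. coord laurent_ring H I C h z \<noteq> 0}"
    "{z. coord laurent_ring H I C h z \<noteq> 0} \<subseteq> I"
    using HM.coord_support[OF C h] by simp_all
  have "C i \<in> carrier H" if "i \<in> I" for i using C that by (auto simp: is_basis_def)
  then have "rep_matrix \<rho> (\<Oplus>\<^bsub>H\<^esub>z\<in>{z. coord laurent_ring H I C h z \<noteq> 0}.
        coord laurent_ring H I C h z \<odot>\<^bsub>H\<^esub> C z) u v
      = (\<Sum>z | coord laurent_ring H I C h z \<noteq> 0.
    of_laurent (coord laurent_ring H I C h z) * rep_matrix \<rho> (C z) u v)"
    using sup by (intro rep_matrix_lin_comb[OF u]) auto
  then show ?thesis using HM.coord_expansion[OF C h] by simp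
qed

end


section \<open>Comparison with the \<open>a\<close>-function\<close>

text \<open>The degree comparison for one representation. The assumption \<open>outside\<close>
  packages B1 with the maximality of the cell: an index outside \<open>\<Gamma>\<close> that acts
  nontrivially already satisfies the bound. A violation on \<open>\<Gamma>\<close> would give an
  integral relation between leading matrices.\<close>

lemma (in hecke_matrix_rep) structure_constant_degree_le:
  assumes C: "is_basis laurent_ring H I C" and xy: "x \<in> I" "y \<in> I"
    and deg: "\<And>w u v. w \<in> I \<Longrightarrow> u \<in> B \<Longrightarrow> v \<in> B \<Longrightarrow> q_degree_le (rep_matrix \<rho> (C w) u v) a"
    and free: "matrices_free_over_int B \<Gamma>
      (\<lambda>w u v. sp (of_laurent (q_pow (- a)) * rep_matrix \<rho> (C w) u v))"
    and outside: "\<And>z k. z \<in> I \<Longrightarrow> z \<notin> \<Gamma> \<Longrightarrow> \<not> zero_matrix_on B (rep_matrix \<rho> (C z)) \<Longrightarrow> k > a \<Longrightarrow>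
      Poly_Mapping.lookup (coord laurent_ring H I C (C x \<otimes>\<^bsub>H\<^esub> C y) z) k = 0"
    and z: "z \<in> \<Gamma>" and k: "k > a"
  shows "Poly_Mapping.lookup (coord laurent_ring H I C (C x \<otimes>\<^bsub>H\<^esub> C y) z) k = 0"
proof (rule ccontr)
  define h where "h = coord laurent_ring H I C (C x \<otimes>\<^bsub>H\<^esub> C y)"
  assume "Poly_Mapping.lookup (coord laurent_ring H I C (C x \<otimes>\<^bsub>H\<^esub> C y) z) k \<noteq> 0"
  then have nz: "Poly_Mapping.lookup (h z) k \<noteq> 0" by (simp add: h_def)
  have CH: "C w \<in> carrier H" if "w \<in> I" for w using C that by (auto simp: is_basis_def)
  define Z where "Z = {w. h w \<noteq> 0}"
  have prod: "C x \<otimes>\<^bsub>H\<^esub> C y \<in> carrier H" using CH xy by simp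
  have Z: "finite Z" "Z \<subseteq> I"
    using HM.coord_support[OF C prod] by (simp_all add: Z_def h_def)
  \<comment> \<open>All exponents occurring in the \<open>h w\<close> with \<open>w\<close> in
    \<open>\<Gamma>\<close>. Their maximum \<open>N\<close> is one common top degree, attained by
    some \<open>w0\<close> but not necessarily by every \<open>w\<close>.\<close>
  define D where "D = (\<Union>w\<in>Z \<inter> \<Gamma>. Poly_Mapping.keys (h w))"
  have finD: "finite D" using Z by (simp add: D_def)
  have kD: "k \<in> D" using nz z by (auto simp: D_def Z_def in_keys_iff intro!: bexI[of _ z])
  define N where "N = Max D"
  have N: "N > a" using Max_ge[OF finD kD] k by (simp add: N_def)
  have above_N: "Poly_Mapping.lookup (h w) j = 0" if "w \<in> \<Gamma>" "j > N" for w j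
  proof (rule ccontr)
    assume "Poly_Mapping.lookup (h w) j \<noteq> 0"
    then have "j \<in> D" using that(1) by (auto simp: D_def Z_def in_keys_iff intro!: bexI[of _ w])
    then show False using Max_ge[OF finD] that(2) by (fastforce simp: N_def)
  qed
  have "N \<in> D" unfolding N_def using finD kD by (intro Max_in) auto
  then obtain w0 where w0: "w0 \<in> Z" "w0 \<in> \<Gamma>" "Poly_Mapping.lookup (h w0) N \<noteq> 0"
    by (auto simp: D_def in_keys_iff)
  \<comment> \<open>Compare the coefficients of \<open>q\<^bsup>N + a\<^esup>\<close> in \<open>\<pi>(C\<^sub>x) \<pi>(C\<^sub>y) = \<Sum>\<^sub>w h\<^sub>w \<pi>(C\<^sub>w)\<close>: the left-hand side has
    degree at most \<open>2 a < N + a\<close>.\<close>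
  have top: "Poly_Mapping.lookup (h w * Poly_Mapping.lookup (rep_matrix \<rho> (C w) u v) e) (N + a)
      = (if w \<in> \<Gamma> then Poly_Mapping.lookup (h w) N *
          Poly_Mapping.lookup (Poly_Mapping.lookup (rep_matrix \<rho> (C w) u v) e) a else 0)"
    if w: "w \<in> Z" and uv: "u \<in> B" "v \<in> B" for w u v e
  proof -
    have wI: "w \<in> I" using w Z by auto
    have dw: "Poly_Mapping.lookup (Poly_Mapping.lookup (rep_matrix \<rho> (C w) u v) e) j = 0"
      if "j > a" for j
      using deg[OF wI uv] that by (simp add: q_degree_le_def)
    show ?thesis
    proof (cases "w \<in> \<Gamma>")
      case True
      then show ?thesis using laurent_lookup_mult_top[OF above_N[OF True] dw] by simp
    next
      case False
      \<comment> \<open>Outside \<open>\<Gamma>\<close> either the matrix vanishes, or both factors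
        have degree at most \<open>a\<close> and the product stays below
        \<open>N + a\<close>.\<close>
      show ?thesis
      proof (cases "zero_matrix_on B (rep_matrix \<rho> (C w))")
        case True
        then show ?thesis using False uv by (simp add: zero_matrix_on_def)
      next
        case nonzero: False
        have "Poly_Mapping.lookup (h w) j = 0" if "j > a" for j
          using outside[OF wI False nonzero that] by (simp add: h_def)
        then have "Poly_Mapping.lookup
            (h w * Poly_Mapping.lookup (rep_matrix \<rho> (C w) u v) e) (N + a) = 0"
          using dw N by (intro laurent_lookup_mult_above[of a _ a]) auto
        then show ?thesis using False by simp
      qed
    qed
  qed
  \<comment> \<open>The scalars of the relation are the coefficients of \<open>h w\<close> at the
    common exponent \<open>N\<close>; those of smaller degree contribute zero.\<close>
  have "zero_matrix_on B (\<lambda>u v. \<Sum>w\<in>Z \<inter> \<Gamma>. of_int (Poly_Mapping.lookup (h w) N) *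
      sp (of_laurent (q_pow (- a)) * rep_matrix \<rho> (C w) u v))"
    unfolding zero_matrix_on_def
  proof (intro ballI poly_mapping_eqI)
    fix u v e j assume uv: "u \<in> B" "v \<in> B"
    let ?P = "rep_matrix \<rho> (C x \<otimes>\<^bsub>H\<^esub> C y) u v"
    \<comment> \<open>The intermediate index of the matrix product ranges over a support, which lies
      in \<open>B\<close>, where \<open>deg\<close> applies.\<close>
    have inB: "w \<in> B" if "rep_matrix \<rho> (C x) u w \<noteq> 0" for w
      using M.coord_support(2)[OF basis_B act_closed[OF CH[OF xy(1)] basis_closed[OF uv(1)]]] that
      by (auto simp: rep_matrix_def)
    have "q_degree_le ?P (a + a)"
      unfolding rep_matrix_mult[OF CH[OF xy(1)] CH[OF xy(2)] uv(1)]
      using deg xy uv inB by (intro q_degree_le_sum q_degree_le_mult) auto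
    then have "0 = Poly_Mapping.lookup (Poly_Mapping.lookup ?P e) (N + a)"
      using N by (simp add: q_degree_le_def)
    also have "?P = (\<Sum>w\<in>Z. of_laurent (h w) * rep_matrix \<rho> (C w) u v)"
      using rep_matrix_expansion[OF C prod uv(1), of v] by (simp add: Z_def h_def)
    also have "Poly_Mapping.lookup (Poly_Mapping.lookup \<dots> e) (N + a) =
        (\<Sum>w\<in>Z. if w \<in> \<Gamma> then Poly_Mapping.lookup (h w) N *
          Poly_Mapping.lookup (Poly_Mapping.lookup (rep_matrix \<rho> (C w) u v) e) a else 0)"
      by (simp add: lookup_sum lookup_of_laurent_mult top uv)
    also have "\<dots> = (\<Sum>w\<in>Z \<inter> \<Gamma>. Poly_Mapping.lookup (h w) N *
          Poly_Mapping.lookup (Poly_Mapping.lookup (rep_matrix \<rho> (C w) u v) e) a)"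
      using Z by (simp add: sum.inter_restrict)
    finally have sum0: "(\<Sum>w\<in>Z \<inter> \<Gamma>. Poly_Mapping.lookup (h w) N *
          Poly_Mapping.lookup (Poly_Mapping.lookup (rep_matrix \<rho> (C w) u v) e) a) = 0" by simp
    \<comment> \<open>After the shift by \<open>- a\<close>, \<open>sp\<close> retains exactly the
      coefficient at exponent \<open>a\<close> and places it at exponent 0.\<close>
    have "Poly_Mapping.lookup (Poly_Mapping.lookup (of_int (Poly_Mapping.lookup (h w) N) *
        sp (of_laurent (q_pow (- a)) * rep_matrix \<rho> (C w) u v)) e) j
      = (Poly_Mapping.lookup (h w) N *
          Poly_Mapping.lookup (Poly_Mapping.lookup (rep_matrix \<rho> (C w) u v) e) a when j = 0)" for w
      by (simp add: lookup_of_int_mult lookup_sp lookup_of_laurent_mult lookup_q_pow_mult when_def)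
    then show "Poly_Mapping.lookup (Poly_Mapping.lookup
        (\<Sum>w\<in>Z \<inter> \<Gamma>. of_int (Poly_Mapping.lookup (h w) N) *
          sp (of_laurent (q_pow (- a)) * rep_matrix \<rho> (C w) u v)) e) j
        = Poly_Mapping.lookup (Poly_Mapping.lookup 0 e) j"
      using sum0 by (cases "j = 0") (simp_all add: lookup_sum)
  qed
  moreover have "finite (Z \<inter> \<Gamma>)" "Z \<inter> \<Gamma> \<subseteq> \<Gamma>" using Z by auto
  ultimately have "\<forall>w\<in>Z \<inter> \<Gamma>. Poly_Mapping.lookup (h w) N = 0"
    using free unfolding matrices_free_over_int_def by (elim allE impE) assumption+
  then show False using w0 by auto
qed

text \<open>The uniform bound puts \<open>a\<close> into the set whose infimum is taken, and the
  nonzero coefficient at \<open>a\<close> excludes every smaller \<open>n\<close>.\<close>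

lemma lusztig_a_eqI:
  assumes "\<And>x y k. x \<in> carrier W \<Longrightarrow> y \<in> carrier W \<Longrightarrow> k > int a \<Longrightarrow>
      Poly_Mapping.lookup (kl_struct W H C x y z) k = 0"
    and "x \<in> carrier W" "y \<in> carrier W" "Poly_Mapping.lookup (kl_struct W H C x y z) (int a) \<noteq> 0"
  shows "lusztig_a W H C z = enat a"
proof (rule antisym)
  show "lusztig_a W H C z \<le> enat a"
    unfolding lusztig_a_def using assms(1) by (intro Inf_lower) (auto simp: q_pow_mult_nonpos_iff)
  show "enat a \<le> lusztig_a W H C z"
    unfolding lusztig_a_def
  proof (rule Inf_greatest, clarsimp simp: q_pow_mult_nonpos_iff)
    fix n assume "\<forall>x\<in>carrier W. \<forall>y\<in>carrier W. \<forall>k>int n. Poly_Mapping.lookup (kl_struct W H C x y z) k = 0"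
    then show "a \<le> n" using assms(2-4) by (meson not_le of_nat_less_iff)
  qed
qed

section \<open>The preorder \<open>le_LR\<close> and its two-sided cells\<close>

lemma le_LR_carrier:
  assumes "le_LR W H C x y"
  shows "x \<in> carrier W" "y \<in> carrier W"
  using assms unfolding le_LR_def by (induction rule: tranclp_induct) auto

lemma le_LR_trans: "le_LR W H C x y \<Longrightarrow> le_LR W H C y z \<Longrightarrow> le_LR W H C x z"
  unfolding le_LR_def by (rule tranclp_trans)

text \<open>A transitive closure need not be reflexive. Here multiplying \<open>C x\<close> by 1 on
  both sides gives reflexivity, so every element lies in its own class.\<close>

lemma le_LR_refl:
  assumes "ring H" "module laurent_ring H" "is_basis laurent_ring H (carrier W) C" "x \<in> carrier W"
  shows "le_LR W H C x x"
proof -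
  interpret H: ring H by fact
  interpret HM: module laurent_ring H by fact
  have "C x \<in> carrier H" using assms(3,4) by (auto simp: is_basis_def)
  then have "kl_coeff W H C (\<one>\<^bsub>H\<^esub> \<otimes>\<^bsub>H\<^esub> C x \<otimes>\<^bsub>H\<^esub> \<one>\<^bsub>H\<^esub>) x \<noteq> 0"
    using HM.coord_basis[OF assms(3,4)] by (simp add: kl_coeff_def)
  then show ?thesis
    unfolding le_LR_def using assms(4) by (intro tranclp.r_into_trancl) blast
qed

lemma two_sided_cell_of:
  assumes "ring H" "module laurent_ring H" "is_basis laurent_ring H (carrier W) C" "x \<in> carrier W"
  obtains \<Gamma> where "\<Gamma> \<in> two_sided_cells W H C" "x \<in> \<Gamma>"
proof
  let ?r = "{(x, y). le_LR W H C x y \<and> le_LR W H C y x}"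
  show "?r `` {x} \<in> two_sided_cells W H C"
    unfolding two_sided_cells_def using assms(4) by (rule quotientI)
  show "x \<in> ?r `` {x}" using le_LR_refl[OF assms] by simp
qed

text \<open>The cell is the class of some unspecified element; by transitivity any member
  \<open>z\<close> can replace it.\<close>

lemma two_sided_cell_iff:
  assumes "\<Gamma> \<in> two_sided_cells W H C" "z \<in> \<Gamma>"
  shows "w \<in> \<Gamma> \<longleftrightarrow> le_LR W H C z w \<and> le_LR W H C w z"
proof -
  obtain x where "\<Gamma> = {y. le_LR W H C x y \<and> le_LR W H C y x}"
    using assms(1) unfolding two_sided_cells_def by (auto elim!: quotientE)
  then show ?thesis using assms(2) by (auto intro: le_LR_trans)
qed

theorem theorem2p6:
  fixes W :: "('w, 'b) monoid_scheme"
    and S :: "'w set"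
    and L :: "'w \<Rightarrow> nat"
    and H :: "(laurent, 'h) module"
    and T C :: "'w \<Rightarrow> 'h"
    and \<rho> :: "'w set \<Rightarrow> ('h, 'm) matrix_rep"
  assumes "coxeter_system W S"
    and "finite S"
    and "positive_weight W S L"
    and "hecke_algebra W S L H T"
    and "kl_basis W S H T C"
    and rep: "\<And>\<Gamma>. \<Gamma> \<in> two_sided_cells W H C \<Longrightarrow> matrix_representation H (\<rho> \<Gamma>)"
    and B1: "\<And>\<Gamma> w. \<Gamma> \<in> two_sided_cells W H C \<Longrightarrow> w \<in> carrier W \<Longrightarrow> w \<notin> cell_above W H C \<Gamma> \<Longrightarrow>
      zero_matrix_on (rep_basis (\<rho> \<Gamma>)) (rep_matrix (\<rho> \<Gamma>) (C w))"
    and B2: "\<And>\<Gamma>. \<Gamma> \<in> two_sided_cells W H C \<Longrightarrow> rep_bounded W C (\<rho> \<Gamma>)"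
    and B3: "\<And>\<Gamma> w. \<Gamma> \<in> two_sided_cells W H C \<Longrightarrow> w \<in> carrier W \<Longrightarrow>
      \<not> zero_matrix_on (rep_basis (\<rho> \<Gamma>)) (leading_matrix W C (\<rho> \<Gamma>) w) \<longleftrightarrow> w \<in> \<Gamma>"
    and B4: "\<And>\<Gamma>. \<Gamma> \<in> two_sided_cells W H C \<Longrightarrow>
      matrices_free_over_int (rep_basis (\<rho> \<Gamma>)) \<Gamma> (leading_matrix W C (\<rho> \<Gamma>))"
    and B5: "\<And>\<Gamma> \<Gamma>'. \<Gamma> \<in> two_sided_cells W H C \<Longrightarrow> \<Gamma>' \<in> two_sided_cells W H C \<Longrightarrow>
      cell_le W H C \<Gamma>' \<Gamma> \<Longrightarrow> rep_bound W C (\<rho> \<Gamma>') \<ge> rep_bound W C (\<rho> \<Gamma>)"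
    and B4': "\<And>\<Gamma> z. \<Gamma> \<in> two_sided_cells W H C \<Longrightarrow> z \<in> \<Gamma> \<Longrightarrow>
      \<exists>x\<in>\<Gamma>. \<exists>y\<in>\<Gamma>. Poly_Mapping.lookup (kl_struct W H C x y z) (int (rep_bound W C (\<rho> \<Gamma>))) \<noteq> 0"
  shows "\<forall>\<Gamma>\<in>two_sided_cells W H C. \<forall>w\<in>\<Gamma>. lusztig_a W H C w = enat (rep_bound W C (\<rho> \<Gamma>))"
proof (intro ballI)
  let ?a = "\<lambda>\<Gamma>. rep_bound W C (\<rho> \<Gamma>)" and ?h = "kl_struct W H C"
  have H: "ring H" "module laurent_ring H"
    using assms(4) by (simp_all add: hecke_algebra_def)
  have C: "is_basis laurent_ring H (carrier W) C"
    using assms(5) by (simp add: kl_basis_def)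
  have rep_locale: "hecke_matrix_rep H (\<rho> \<Gamma>)" if "\<Gamma> \<in> two_sided_cells W H C" for \<Gamma>
    using H rep[OF that] by (simp add: hecke_matrix_rep_def hecke_matrix_rep_axioms_def)
  have CH: "C w \<in> carrier H" if "w \<in> carrier W" for w using C that by (auto simp: is_basis_def)
  have upper: "Poly_Mapping.lookup (?h x y z) k = 0"
    if xy: "x \<in> carrier W" "y \<in> carrier W" and z: "\<Gamma> \<in> two_sided_cells W H C" "z \<in> \<Gamma>" "k > int (?a \<Gamma>)"
    for x y z k \<Gamma>
  proof (rule ccontr)
    assume nz: "Poly_Mapping.lookup (?h x y z) k \<noteq> 0"
    \<comment> \<open>With \<open>x\<close> and \<open>y\<close> fixed, these are the indices
      violating the bound of their own cell. They lie in the finite support of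
      \<open>C x \<otimes> C y\<close>.\<close>
    define Bad where "Bad = {z. \<exists>\<Gamma> k. \<Gamma> \<in> two_sided_cells W H C \<and> z \<in> \<Gamma> \<and> k > int (?a \<Gamma>) \<and>
      Poly_Mapping.lookup (?h x y z) k \<noteq> 0}"
    interpret HM: module laurent_ring H by (rule H)
    interpret HR: ring H by (rule H)
    have "finite {z. coord laurent_ring H (carrier W) C (C x \<otimes>\<^bsub>H\<^esub> C y) z \<noteq> 0}"
      using HM.coord_support(1)[OF C, of "C x \<otimes>\<^bsub>H\<^esub> C y"] CH xy by simp
    then have "finite Bad"
      by (rule rev_finite_subset) (auto simp: Bad_def kl_struct_def kl_coeff_def)
    moreover have "Bad \<noteq> {}" using z nz by (auto simp: Bad_def)
    \<comment> \<open>\<open>le_LR\<close> is only a preorder, so a maximal element is chosen for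
      its strict part.\<close>
    moreover have "asymp_on Bad (\<lambda>x y. le_LR W H C x y \<and> \<not> le_LR W H C y x)"
      by (simp add: asymp_on_def)
    moreover have "transp_on Bad (\<lambda>x y. le_LR W H C x y \<and> \<not> le_LR W H C y x)"
      unfolding transp_on_def by (blast intro: le_LR_trans)
    ultimately obtain m where m: "m \<in> Bad"
      and max: "\<And>w. w \<in> Bad \<Longrightarrow> w \<noteq> m \<Longrightarrow> \<not> (le_LR W H C m w \<and> \<not> le_LR W H C w m)"
      using Finite_Set.bex_max_element[of Bad "\<lambda>x y. le_LR W H C x y \<and> \<not> le_LR W H C y x"]
      by meson
    from m obtain \<Delta> j where D: "\<Delta> \<in> two_sided_cells W H C" "m \<in> \<Delta>" "j > int (?a \<Delta>)"
      "Poly_Mapping.lookup (?h x y m) j \<noteq> 0" by (auto simp: Bad_def)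
    interpret hecke_matrix_rep H "\<rho> \<Delta>" by (rule rep_locale[OF D(1)])
    \<comment> \<open>B2 ensures that the \<open>LEAST\<close> defining \<open>rep_bound\<close> is
      itself a bound.\<close>
    have bounded: "rep_bounded_by W C (\<rho> \<Delta>) (?a \<Delta>)"
      using B2[OF D(1)] unfolding rep_bounded_def rep_bound_def by (rule LeastI_ex)
    have "Poly_Mapping.lookup (coord laurent_ring H (carrier W) C (C x \<otimes>\<^bsub>H\<^esub> C y) m) j = 0"
    proof (rule structure_constant_degree_le[OF C xy _ _ _ D(2,3)])
      show "q_degree_le (rep_matrix (\<rho> \<Delta>) (C w) u v) (int (?a \<Delta>))"
        if "w \<in> carrier W" "u \<in> B" "v \<in> B" for w u v
        using bounded that unfolding rep_bounded_by_def
        by (blast intro: of_laurent_mult_nonpos_imp_degree_le)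
      show "matrices_free_over_int B \<Delta>
          (\<lambda>w u v. sp (of_laurent (q_pow (- int (?a \<Delta>))) * rep_matrix (\<rho> \<Delta>) (C w) u v))"
        using B4[OF D(1)] by (simp add: leading_matrix_def[abs_def])
      fix w i
      assume w: "w \<in> carrier W" "w \<notin> \<Delta>" "\<not> zero_matrix_on B (rep_matrix (\<rho> \<Delta>) (C w))"
        and i: "i > int (?a \<Delta>)"
      \<comment> \<open>A nonzero matrix forces \<open>w\<close> to lie above
        \<open>\<Delta>\<close>, by the contrapositive of B1.\<close>
      from B1[OF D(1) w(1)] w(3) obtain m' where m': "m' \<in> \<Delta>" "le_LR W H C m' w"
        by (auto simp: cell_above_def)
      have mw: "le_LR W H C m w"
        using m' two_sided_cell_iff[OF D(1,2)] by (blast intro: le_LR_trans)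
      \<comment> \<open>Since \<open>w\<close> is not in \<open>\<Delta>\<close>, it lies strictly
        above \<open>m\<close>, and maximality removes it from \<open>Bad\<close>.\<close>
      then have "\<not> le_LR W H C w m" using w(2) two_sided_cell_iff[OF D(1,2)] by blast
      then have notbad: "w \<notin> Bad" using max[of w] mw by auto
      obtain \<Gamma>' where \<Gamma>': "\<Gamma>' \<in> two_sided_cells W H C" "w \<in> \<Gamma>'"
        using two_sided_cell_of[OF H C w(1)] by blast
      \<comment> \<open>By B5 the bound decreases weakly going up, so \<open>i\<close> also exceeds
        the bound of the cell of \<open>w\<close>, where \<open>w\<close> is known to be
        good.\<close>
      have "?a \<Gamma>' \<le> ?a \<Delta>"
        using \<Gamma>' D m' by (intro B5) (auto simp: cell_le_def)
      then show "Poly_Mapping.lookup (coord laurent_ring H (carrier W) C (C x \<otimes>\<^bsub>H\<^esub> C y) w) i = 0"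
        using notbad \<Gamma>' i unfolding Bad_def kl_struct_def kl_coeff_def by force
    qed
    then show False using D(4) by (simp add: kl_struct_def kl_coeff_def)
  qed
  fix \<Gamma> w assume \<Gamma>: "\<Gamma> \<in> two_sided_cells W H C" "w \<in> \<Gamma>"
  \<comment> \<open>B4' supplies a structure constant reaching the bound, which gives the lower
    estimate; \<open>upper\<close> gives the other one.\<close>
  obtain x y where xy: "x \<in> \<Gamma>" "y \<in> \<Gamma>" "Poly_Mapping.lookup (?h x y w) (int (?a \<Gamma>)) \<noteq> 0"
    using B4'[OF \<Gamma>] by blast
  have "v \<in> carrier W" if "v \<in> \<Gamma>" for v
    using iffD1[OF two_sided_cell_iff[OF \<Gamma>] that] by (auto dest: le_LR_carrier)
  with xy show "lusztig_a W H C w = enat (?a \<Gamma>)"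
    by (intro lusztig_a_eqI[of W _ H C w x y] upper[OF _ _ \<Gamma>])
qed

end
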